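(* Let $X$ be a non-empty set and let $\Omega$ be a class of infinite sequences in $X$, whose members are called '$I$-convergent sequences', each member of $\Omega$ being associated with an element of $X$ called an '$I$-limit' of the sequence, subject to the following conditions: C(1): for every $x_0\in X$ the constant sequence $\{x_0,x_0,x_0,\ldots\}$ is $I$-convergent (i.e. belongs to $\Omega$) with $I$-limit $x_0$; C(2): addition of a finite number of terms to a sequence affects neither its $I$-convergence (membership in $\Omega$) nor its $I$-limit; C(3): if a sequence $\{x_n\}$ is $I$-convergent with $I$-limit $x_0\in X$, then every subsequence of it is $I$-convergent with the same $I$-limit $x_0$. Call a subset $G\subset X$ open if and only if no sequence lying in $X-G$ (i.e. all of whose terms lie in $X-G$) has any $I$-limit in $G$. Then the collection $\sigma$ of all such open sets is a topology on $X$.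
   Context: Here '$I$-convergent' and '$I$-limit' are purely names for the abstract data: membership of a sequence in the given class $\Omega$, and the given association between members of $\Omega$ and elements of $X$ (a relation under which every member of $\Omega$ has at least one associated $I$-limit; uniqueness is not assumed). No topology on $X$ is given beforehand. A sequence not in $\Omega$ has no $I$-limit. *)

theory Defs
  imports "HOL-Analysis.Abstract_Topology"
begin

text \<open>\<open>y\<close> arises from \<open>x\<close> by inserting finitely many terms, at any positions: \<open>r\<close> gives the new
  positions of the old terms.\<close>

definition adds_finitely_many :: "(nat \<Rightarrow> 'a) \<Rightarrow> (nat \<Rightarrow> 'a) \<Rightarrow> bool" where
  "adds_finitely_many x y \<longleftrightarrow>
     (\<exists>r :: nat \<Rightarrow> nat. strict_mono r \<and> finite (- range r) \<and> x = y \<circ> r)"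

text \<open>\<open>Ilim x l\<close> says that \<open>l\<close> is an \<open>I\<close>-limit of \<open>x\<close>. It is a relation because limits need not
  be unique.\<close>

locale I_convergence =
  fixes X :: "'a set"
    and \<Omega> :: "(nat \<Rightarrow> 'a) set"
    and Ilim :: "(nat \<Rightarrow> 'a) \<Rightarrow> 'a \<Rightarrow> bool"
  assumes nonempty: "X \<noteq> {}"
    and seq_in: "x \<in> \<Omega> \<Longrightarrow> range x \<subseteq> X"
    and limit_exists: "x \<in> \<Omega> \<Longrightarrow> \<exists>l. Ilim x l"
    and limit_in: "Ilim x l \<Longrightarrow> x \<in> \<Omega> \<and> l \<in> X"
    and C1: "x0 \<in> X \<Longrightarrow> (\<lambda>_. x0) \<in> \<Omega> \<and> Ilim (\<lambda>_. x0) x0"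
    and C2: "range x \<subseteq> X \<Longrightarrow> range y \<subseteq> X \<Longrightarrow> adds_finitely_many x y \<Longrightarrow>
               (y \<in> \<Omega> \<longleftrightarrow> x \<in> \<Omega>) \<and> (\<forall>l. Ilim y l \<longleftrightarrow> Ilim x l)"
    and C3: "x \<in> \<Omega> \<Longrightarrow> Ilim x x0 \<Longrightarrow> strict_mono (r :: nat \<Rightarrow> nat) \<Longrightarrow>
               x \<circ> r \<in> \<Omega> \<and> Ilim (x \<circ> r) x0"

definition I_open :: "'a set \<Rightarrow> ((nat \<Rightarrow> 'a) \<Rightarrow> 'a \<Rightarrow> bool) \<Rightarrow> 'a set \<Rightarrow> bool" where
  "I_open X Ilim G \<longleftrightarrow>
     G \<subseteq> X \<and> \<not> (\<exists>x l. range x \<subseteq> X - G \<and> l \<in> G \<and> Ilim x l)"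

end

theory Submission
  imports Defs
begin

text \<open>Only finite intersections need an argument: a sequence avoiding \<open>S \<inter> T\<close> avoids one of \<open>S\<close>, \<open>T\<close>
  infinitely often, and by C(3) the subsequence of those terms keeps every limit of the sequence.\<close>

text \<open>Recasts openness as a condition on tails: the exceptional indices form a finite set, and
  finite sets are closed under union, which suits intersections of open sets.\<close>

lemma (in I_convergence) finite_outside_open:
  assumes "I_open X Ilim G" "Ilim x l" "l \<in> G"
  shows "finite {n. x n \<notin> G}"
proof (rule ccontr)
  assume "infinite {n. x n \<notin> G}"
  then obtain r :: "nat \<Rightarrow> nat" where r: "strict_mono r" "\<And>n. x (r n) \<notin> G"
    using infinite_enumerate by blast
  have x: "x \<in> \<Omega>"
    using assms(2) limit_in by blast
  then have "Ilim (x \<circ> r) l"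
    using C3 assms(2) r(1) by blast
  moreover have "range (x \<circ> r) \<subseteq> X - G"
    \<comment> \<open>\<open>r\<close> only avoids \<open>G\<close>; \<open>seq_in\<close> keeps the
      terms inside \<open>X\<close>.\<close>
    using seq_in[OF x] r(2) by auto
  ultimately show False
    using assms(1,3) unfolding I_open_def by blast
qed

lemma (in I_convergence) I_open_Int:
  assumes S: "I_open X Ilim S" and T: "I_open X Ilim T"
  shows "I_open X Ilim (S \<inter> T)"
proof -
  have False if "range x \<subseteq> X - S \<inter> T" "l \<in> S \<inter> T" "Ilim x l" for x l
  proof -
    have "finite ({n. x n \<notin> S} \<union> {n. x n \<notin> T})"
      using finite_outside_open[OF S that(3)] finite_outside_open[OF T that(3)] that(2) by simp
    \<comment> \<open>Each term misses \<open>S\<close> or \<open>T\<close>, so two finite sets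
      would cover all of the naturals.\<close>
    moreover have "{n. x n \<notin> S} \<union> {n. x n \<notin> T} = UNIV"
      using that(1) by auto
    ultimately show False
      by simp
  qed
  then show ?thesis
    using S unfolding I_open_def by blast
qed

text \<open>A limit in the union lies in some member \<open>S\<close>, and a sequence avoiding the
  union avoids that \<open>S\<close>.\<close>

lemma I_open_Union:
  assumes "\<And>S. S \<in> K \<Longrightarrow> I_open X Ilim S"
  shows "I_open X Ilim (\<Union>K)"
  unfolding I_open_def
proof (intro conjI notI)
  show "\<Union>K \<subseteq> X"
    using assms unfolding I_open_def by blast
  assume "\<exists>x l. range x \<subseteq> X - \<Union>K \<and> l \<in> \<Union>K \<and> Ilim x l"
  then obtain x l S where "range x \<subseteq> X - \<Union>K" "S \<in> K" "l \<in> S" "Ilim x l"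
    by blast
  moreover from this have "range x \<subseteq> X - S"
    by blast
  ultimately show False
    using assms unfolding I_open_def by blast
qed

lemma I_open_carrier: "I_open X Ilim X"
  \<comment> \<open>The range of a sequence is nonempty, so it cannot lie in
    \<open>X - X\<close>.\<close>
  unfolding I_open_def by auto

theorem theorem2p4:
  fixes X :: "'a set"
    and \<Omega> :: "(nat \<Rightarrow> 'a) set"
    and Ilim :: "(nat \<Rightarrow> 'a) \<Rightarrow> 'a \<Rightarrow> bool"
  assumes "I_convergence X \<Omega> Ilim"
  shows "istopology (I_open X Ilim) \<and> topspace (topology (I_open X Ilim)) = X"
proof
  interpret I_convergence X \<Omega> Ilim
    by (fact assms)
  show top: "istopology (I_open X Ilim)"
    \<comment> \<open>Openness of the empty set is the case of the empty union.\<close>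
    unfolding istopology_def using I_open_Int I_open_Union by blast
  \<comment> \<open>\<open>istopology\<close> does not mention a carrier; \<open>topspace\<close> is
    the union of all open sets, the largest of which is \<open>X\<close>.\<close>
  have "\<Union>{S. I_open X Ilim S} = X"
    using I_open_carrier unfolding I_open_def by blast
  then show "topspace (topology (I_open X Ilim)) = X"
    by (simp add: topspace_def topology_inverse'[OF top])
qed

end
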